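(* The shift map $\sigma\colon[0,1]^{\mathbb Z}\to[0,1]^{\mathbb Z}$, $\sigma((x_i)_{i\in\mathbb Z})=(x_{i+1})_{i\in\mathbb Z}$, where $[0,1]^{\mathbb Z}$ is endowed with the metric $d(\underline x,\underline y)=\sup_{i\in\mathbb Z}\frac{|x_i-y_i|}{2^{|i|}}$, is first-time sensitive.
   Context: Let $(X,d)$ be a compact metric space and $B(x,r)$ its open balls. A map $f\colon X\to X$ is sensitive if there is $\varepsilon>0$ (a sensitivity constant) such that for every $x\in X$ and every $\delta>0$ there exist $y\in X$ with $d(x,y)<\delta$ and $n\in\mathbb N$ with $d(f^n(x),f^n(y))>\varepsilon$. Any $\gamma\in(0,\varepsilon]$ is then also a sensitivity constant. For a sensitive homeomorphism and a sensitivity constant $\gamma$, the first increasing time $n_1(x,r,\gamma)$ is the first iterate $n\ge 0$ with $\operatorname{diam} f^{n}(B(x,r))>\gamma$. A sensitive homeomorphism $f$ with sensitivity constant $\varepsilon$ is first-time sensitive if there is a sequence of functions $r_k\colon X\to(0,\infty)$, $k\in\mathbb N=\{1,2,\dots\}$, with $r_1$ constant and $(r_k(x))_k$ decreasing monotonically to $0$ for each $x$, such that for each $\gamma\in(0,\varepsilon]$ there is $m_\gamma>0$ satisfying (F1) $|n_1(x,r_{k+1}(x),\gamma)-n_1(x,r_k(x),\gamma)|\leq m_\gamma$ and (F2) $|n_1(x,r_k(x),\gamma)-n_1(x,r_k(x),\varepsilon)|\leq m_\gamma$ for every $x\in X$ and every $k\in\mathbb N$ with $r_k(x)\leq\gamma$.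 *)

theory Defs
  imports "HOL-Analysis.Analysis"
begin

context Metric_space
begin

text \<open>The library's \<open>diameter\<close> is tied to the type class metric; this is its carrier-based analogue.\<close>

definition mdiameter :: "'a set \<Rightarrow> real" where
  "mdiameter S = (if S = {} then 0 else SUP (x, y)\<in>S \<times> S. d x y)"

definition sensitivity_constant :: "('a \<Rightarrow> 'a) \<Rightarrow> real \<Rightarrow> bool" where
  "sensitivity_constant f \<epsilon> \<longleftrightarrow> \<epsilon> > 0 \<and>
     (\<forall>x\<in>M. \<forall>\<delta>>0. \<exists>y\<in>M. d x y < \<delta> \<and> (\<exists>n\<ge>1. d ((f ^^ n) x) ((f ^^ n) y) > \<epsilon>))"

text \<open>If \<open>f\<close> maps \<open>M\<close> to itself, \<open>M\<close> is bounded, \<open>\<gamma>\<close> is a sensitivity constant of \<open>f\<close>,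
  \<open>x \<in> M\<close> and \<open>r > 0\<close>, some iterate satisfies the condition, so the minimum below is
  attained.\<close>

definition first_increasing_time :: "('a \<Rightarrow> 'a) \<Rightarrow> 'a \<Rightarrow> real \<Rightarrow> real \<Rightarrow> nat" where
  "first_increasing_time f x r \<gamma> = (LEAST n. mdiameter ((f ^^ n) ` mball x r) > \<gamma>)"

text \<open>The sequence \<open>r\<^sub>k\<close> is indexed by \<open>k \<ge> 1\<close>; the value \<open>r 0\<close> plays no role.
  "Decreasing" is read strictly. The non-strict reading gives the same class of maps: for each
  point, deleting repeated radii preserves all the conditions.\<close>

definition first_time_sensitive :: "('a \<Rightarrow> 'a) \<Rightarrow> bool" where
  "first_time_sensitive f \<longleftrightarrow>
     homeomorphic_map mtopology mtopology f \<and>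
     (\<exists>\<epsilon>. sensitivity_constant f \<epsilon> \<and>
       (\<exists>r :: nat \<Rightarrow> 'a \<Rightarrow> real.
          (\<forall>k\<ge>1. \<forall>x\<in>M. r k x > 0) \<and>
          (\<exists>c. \<forall>x\<in>M. r 1 x = c) \<and>
          (\<forall>x\<in>M. (\<forall>k\<ge>1. r (Suc k) x < r k x) \<and> (\<lambda>k. r k x) \<longlonglongrightarrow> 0) \<and>
          (\<forall>\<gamma>. 0 < \<gamma> \<and> \<gamma> \<le> \<epsilon> \<longrightarrow>
             (\<exists>m::real. m > 0 \<and>
               (\<forall>x\<in>M. \<forall>k\<ge>1. r k x \<le> \<gamma> \<longrightarrow>
                  \<bar>real (first_increasing_time f x (r (Suc k) x) \<gamma>)
                     - real (first_increasing_time f x (r k x) \<gamma>)\<bar> \<le> m \<and>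
                  \<bar>real (first_increasing_time f x (r k x) \<gamma>)
                     - real (first_increasing_time f x (r k x) \<epsilon>)\<bar> \<le> m)))))"

end

definition unit_cube :: "(int \<Rightarrow> real) set" where
  "unit_cube = {x. \<forall>i. x i \<in> {0..1}}"

text \<open>The locale \<^locale>\<open>Metric_space\<close> requires non-negativity and symmetry of the distance
  also off the carrier, where the supremum need not exist; hence the default value 0 there.\<close>

definition cube_dist :: "(int \<Rightarrow> real) \<Rightarrow> (int \<Rightarrow> real) \<Rightarrow> real" where
  "cube_dist x y =
     (if x \<in> unit_cube \<and> y \<in> unit_cube then SUP i. \<bar>x i - y i\<bar> / 2 ^ nat \<bar>i\<bar> else 0)"

definition shift :: "(int \<Rightarrow> real) \<Rightarrow> (int \<Rightarrow> real)" where
  "shift x = (\<lambda>i. x (i + 1))"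

end

theory Submission
  imports Defs
begin

text \<open>
  The shift \<open>\<sigma>\<close> stretches distances by a factor of at most \<open>2\<close>, because the weight
  \<open>2 ^ -\<bar>i\<bar>\<close> of a coordinate at most doubles when the coordinate moves by one place; and this
  rate is attained near every point and over any number \<open>n\<close> of iterates, since moving the \<open>n\<close>-th
  coordinate of \<open>x\<close> by \<open>a \<le> 1/2\<close> (up or down, whichever stays in \<open>[0,1]\<close>) changes \<open>x\<close> by
  \<open>a / 2 ^ n\<close> only, while \<open>\<sigma> ^ n\<close> brings that coordinate to the place \<open>0\<close>, where it has weight
  \<open>1\<close>.

  For a homeomorphism of any metric space, these two facts yield first-time sensitivity, with any rate
  \<open>L > 1\<close> in place of \<open>2\<close>. The first forces \<open>diam (f ^ n (B(x,r))) \<le> 2 * r * L ^ n\<close>, and the second makes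
  this diameter exceed \<open>\<gamma>\<close> as soon as \<open>r * L ^ n > \<gamma>\<close>, provided that \<open>\<gamma>\<close> is smaller than the
  largest displacement available (\<open>1/2\<close> for the shift). Hence, for \<open>r \<le> \<gamma>\<close>, the first increasing time
  is \<open>log L (\<gamma> / r)\<close> up to an error independent of \<open>x\<close>, \<open>r\<close> and \<open>\<gamma>\<close>
  (\<open>first_increasing_time_bounds\<close>). With the radii \<open>r\<^sub>k = L ^ -k\<close>, passing from \<open>r\<^sub>k\<close> to
  \<open>r\<^sub>k\<^sub>+\<^sub>1\<close> adds \<open>1\<close> to that logarithm, and passing from \<open>\<gamma>\<close> to \<open>\<epsilon>\<close> adds \<open>log L (\<epsilon> / \<gamma>)\<close>; both
  amounts do not depend on \<open>x\<close> and \<open>k\<close>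
  (\<open>first_time_sensitive_if_exact_expansion_rate\<close>).

  Compactness of the cube comes from Tychonoff's theorem, since the identity is continuous from
  the product topology to the metric topology: up to any prescribed error, the distance depends
  on finitely many coordinates only.
\<close>

section \<open>First-time sensitivity from an exact expansion rate\<close>

context Metric_space
begin

lemma bdd_above_dist_image:
  assumes "\<And>u v. u \<in> S \<Longrightarrow> v \<in> S \<Longrightarrow> d u v \<le> b"
  shows "bdd_above ((\<lambda>(x, y). d x y) ` (S \<times> S))"
  using assms by (intro bdd_aboveI[of _ b]) auto

text \<open>The bound \<open>b\<close> ensures that the supremum in \<^const>\<open>mdiameter\<close> is a true one.\<close>

lemma dist_le_mdiameter:
  assumes "\<And>u v. u \<in> S \<Longrightarrow> v \<in> S \<Longrightarrow> d u v \<le> b" "u \<in> S" "v \<in> S"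
  shows "d u v \<le> mdiameter S"
proof -
  have "(\<lambda>(x, y). d x y) (u, v) \<le> (SUP (x, y)\<in>S \<times> S. d x y)"
    using assms by (intro cSUP_upper bdd_above_dist_image[of S b]) auto
  then show ?thesis using assms by (auto simp: mdiameter_def)
qed

lemma mdiameter_le:
  assumes "\<And>u v. u \<in> S \<Longrightarrow> v \<in> S \<Longrightarrow> d u v \<le> b" "0 \<le> b"
  shows "mdiameter S \<le> b"
  using assms by (auto simp: mdiameter_def intro!: cSUP_least)

lemma Lipschitz_funpow:
  assumes "f ` M \<subseteq> M" "0 \<le> L"
    and "\<And>u v. u \<in> M \<Longrightarrow> v \<in> M \<Longrightarrow> d (f u) (f v) \<le> L * d u v"
    and "u \<in> M" "v \<in> M"
  shows "(f ^^ n) u \<in> M \<and> (f ^^ n) v \<in> M \<and> d ((f ^^ n) u) ((f ^^ n) v) \<le> L ^ n * d u v"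
proof (induction n)
  case 0
  then show ?case using assms by simp
next
  case (Suc n)
  have "d (f ((f ^^ n) u)) (f ((f ^^ n) v)) \<le> L * d ((f ^^ n) u) ((f ^^ n) v)"
    using assms Suc by blast
  also have "\<dots> \<le> L * (L ^ n * d u v)"
    using Suc assms by (intro mult_left_mono) auto
  finally show ?case using assms Suc by (auto simp: mult.assoc)
qed

text \<open>
  Let \<open>D n\<close> be the diameter of the \<open>n\<close>-th image of the ball. The Lipschitz bound gives
  \<open>D n \<le> 2 * r * L ^ n\<close>, so \<open>D n > \<gamma>\<close> cannot happen before \<open>log L (\<gamma> / r) - log L 2\<close>; the
  expansion gives, as \<open>\<gamma> < A\<close>, that \<open>D n > \<gamma>\<close> whenever \<open>r * L ^ n > \<gamma>\<close>, that is, at the latest one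
  step after \<open>log L (\<gamma> / r)\<close>. The assumption \<open>r \<le> \<gamma>\<close> makes this logarithm nonnegative, which
  covers the case that the first increasing time is \<open>0\<close>.
\<close>

lemma first_increasing_time_bounds:
  assumes f: "f ` M \<subseteq> M" and L: "1 < L"
    and Lip: "\<And>u v. u \<in> M \<Longrightarrow> v \<in> M \<Longrightarrow> d (f u) (f v) \<le> L * d u v"
    and expand: "\<And>x n a. x \<in> M \<Longrightarrow> 0 < a \<Longrightarrow> a \<le> A \<Longrightarrow>
      \<exists>y\<in>M. d x y \<le> a / L ^ n \<and> a \<le> d ((f ^^ n) x) ((f ^^ n) y)"
    and x: "x \<in> M" and r: "0 < r" "r \<le> \<gamma>" and \<gamma>: "\<gamma> < A"
  shows "\<bar>real (first_increasing_time f x r \<gamma>) - log L (\<gamma> / r)\<bar> \<le> 1 + log L 2"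
proof -
  define P where "P n \<longleftrightarrow> mdiameter ((f ^^ n) ` mball x r) > \<gamma>" for n
  define N where "N = first_increasing_time f x r \<gamma>"
  have N: "N = (LEAST n. P n)"
    by (simp add: N_def P_def first_increasing_time_def)
  have upper: "d u v \<le> L ^ n * (2 * r)" if "u \<in> (f ^^ n) ` mball x r" "v \<in> (f ^^ n) ` mball x r"
    for u v n
  proof -
    obtain p q where p: "p \<in> M" "d x p < r" "u = (f ^^ n) p" and q: "q \<in> M" "d x q < r" "v = (f ^^ n) q"
      using \<open>u \<in> _\<close> \<open>v \<in> _\<close> by auto
    have "d u v \<le> L ^ n * d p q"
      using Lipschitz_funpow[of f L p q n] f L Lip p q by auto
    also have "d p q \<le> 2 * r"
      using triangle[of p x q] commute[of p x] p q x by linarith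
    finally show ?thesis using L by simp
  qed
  have grow: "P n" if n: "\<gamma> < r * L ^ n" for n
  proof -
    \<comment> \<open>A displacement above \<open>\<gamma>\<close> at time \<open>n\<close> that still starts strictly inside the ball.\<close>
    obtain a where a: "\<gamma> < a" "a < min (r * L ^ n) A"
      using n \<gamma> dense[of \<gamma> "min (r * L ^ n) A"] by auto
    then obtain y where y: "y \<in> M" "d x y \<le> a / L ^ n" "a \<le> d ((f ^^ n) x) ((f ^^ n) y)"
      using expand[of x a n] x r by auto
    have "a / L ^ n < r" using a L by (simp add: divide_less_eq)
    then have "x \<in> mball x r" "y \<in> mball x r" using x y r by auto
    then have "d ((f ^^ n) x) ((f ^^ n) y) \<le> mdiameter ((f ^^ n) ` mball x r)"
      by (intro dist_le_mdiameter[where b="L ^ n * (2 * r)"] upper) auto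
    then show ?thesis using a y by (simp add: P_def)
  qed
  have lower: "\<gamma> < L ^ n * (2 * r)" if "P n" for n
    using mdiameter_le[of "(f ^^ n) ` mball x r" "L ^ n * (2 * r)"] upper[of _ n] that L r
    by (force simp: P_def)
  obtain n0 where "\<gamma> / r < L ^ n0" using real_arch_pow[OF L] by blast
  then have "P n0" using grow r by (simp add: field_simps)
  then have "P N" unfolding N by (rule LeastI)
  then have "\<gamma> / r < 2 * L powr N"
    using lower[of N] L r by (simp add: field_simps powr_realpow)
  then have "log L (\<gamma> / r) < log L (2 * L powr N)"
    using L r by (intro log_less) auto
  also have "\<dots> = log L 2 + N"
    using L by (simp add: log_mult)
  finally have lo: "log L (\<gamma> / r) < log L 2 + N" .
  have log0: "0 \<le> log L (\<gamma> / r)" using L r by simp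
  have hi: "N \<le> log L (\<gamma> / r) + 1"
  proof (cases N)
    case (Suc n)
    then have "\<not> P n" using not_less_Least[of n P] N by simp
    then have "L powr n \<le> \<gamma> / r"
      using grow[of n] L r by (force simp: field_simps powr_realpow)
    then have "n \<le> log L (\<gamma> / r)" using L r by (simp add: le_log_iff)
    then show ?thesis using Suc by simp
  qed (use log0 in simp)
  have "0 \<le> log L 2" using L by simp
  then show ?thesis using lo hi unfolding N_def by linarith
qed

lemma sensitivity_constant_if_expanding:
  assumes L: "1 < L" and \<epsilon>: "0 < \<epsilon>" "\<epsilon> < A"
    and expand: "\<And>x n a. x \<in> M \<Longrightarrow> 0 < a \<Longrightarrow> a \<le> A \<Longrightarrow>
      \<exists>y\<in>M. d x y \<le> a / L ^ n \<and> a \<le> d ((f ^^ n) x) ((f ^^ n) y)"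
  shows "sensitivity_constant f \<epsilon>"
  unfolding sensitivity_constant_def
proof (intro conjI ballI allI impI)
  fix x and \<delta> :: real assume x: "x \<in> M" and \<delta>: "0 < \<delta>"
  \<comment> \<open>Sensitivity asks for a positive time, hence \<open>Suc n\<close> below.\<close>
  obtain n where n: "A / \<delta> < L ^ n" using real_arch_pow[OF L] by blast
  also have "\<dots> \<le> L ^ Suc n" using L by simp
  finally have "A / L ^ Suc n < \<delta>" using \<delta> L by (simp add: field_simps)
  moreover obtain y where "y \<in> M" "d x y \<le> A / L ^ Suc n"
    "A \<le> d ((f ^^ Suc n) x) ((f ^^ Suc n) y)"
    using expand[of x A "Suc n"] x \<epsilon> by auto
  ultimately show "\<exists>y\<in>M. d x y < \<delta> \<and> (\<exists>n\<ge>1. d ((f ^^ n) x) ((f ^^ n) y) > \<epsilon>)"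
    using \<epsilon> by (intro bexI[of _ y] conjI exI[of _ "Suc n"]) auto
qed (use \<epsilon> in simp)

text \<open>
  The constants: \<open>\<epsilon>\<close> has to lie strictly below \<open>A\<close>, because diameters must exceed \<open>\<epsilon>\<close> strictly and
  the displacements supplied by the expansion reach \<open>A\<close> only. The bound \<open>m\<close> adds the errors
  \<open>1 + log L 2\<close> of two first increasing times to the difference of their logarithms, which is \<open>1\<close>
  in one condition and \<open>log L (\<epsilon> / \<gamma>)\<close> in the other.
\<close>

theorem first_time_sensitive_if_exact_expansion_rate:
  assumes homeo: "homeomorphic_map mtopology mtopology f" and L: "1 < L" and A: "0 < A"
    and Lip: "\<And>u v. u \<in> M \<Longrightarrow> v \<in> M \<Longrightarrow> d (f u) (f v) \<le> L * d u v"
    and expand: "\<And>x n a. x \<in> M \<Longrightarrow> 0 < a \<Longrightarrow> a \<le> A \<Longrightarrow>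
      \<exists>y\<in>M. d x y \<le> a / L ^ n \<and> a \<le> d ((f ^^ n) x) ((f ^^ n) y)"
  shows "first_time_sensitive f"
proof -
  define \<epsilon> where "\<epsilon> = A / 2"
  have \<epsilon>: "0 < \<epsilon>" "\<epsilon> < A" using A by (auto simp: \<epsilon>_def)
  define r :: "nat \<Rightarrow> 'a \<Rightarrow> real" where "r k x = 1 / L ^ k" for k x
  have f: "f ` M \<subseteq> M"
    using homeomorphic_imp_surjective_map[OF homeo] by simp
  have r0: "0 < r k x" for k x using L by (simp add: r_def)
  have rS: "r (Suc k) x = r k x / L" for k x by (simp add: r_def)
  have rdec: "r (Suc k) x < r k x" for k x
    using r0[of k x] L by (simp add: rS divide_less_eq)
  have rlim: "(\<lambda>k. r k x) \<longlonglongrightarrow> 0" for x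
    using LIMSEQ_inverse_realpow_zero[OF L] by (simp add: r_def inverse_eq_divide)
  note time = first_increasing_time_bounds[OF f L Lip expand]
  have times: "\<exists>m::real. m > 0 \<and>
               (\<forall>x\<in>M. \<forall>k\<ge>1. r k x \<le> \<gamma> \<longrightarrow>
                  \<bar>real (first_increasing_time f x (r (Suc k) x) \<gamma>)
                     - real (first_increasing_time f x (r k x) \<gamma>)\<bar> \<le> m \<and>
                  \<bar>real (first_increasing_time f x (r k x) \<gamma>)
                     - real (first_increasing_time f x (r k x) \<epsilon>)\<bar> \<le> m)"
    if \<gamma>: "0 < \<gamma>" "\<gamma> \<le> \<epsilon>" for \<gamma>
  proof -
    define m where "m = 3 + 2 * log L 2 + log L (\<epsilon> / \<gamma>)"
    have log2: "0 \<le> log L 2" using L by simp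
    have log\<epsilon>: "0 \<le> log L (\<epsilon> / \<gamma>)" using L \<gamma> by simp
    show ?thesis
    proof (intro exI[of _ m] conjI ballI allI impI)
      show "0 < m" using log2 log\<epsilon> by (simp add: m_def)
    next
      fix x and k :: nat assume x: "x \<in> M" and k: "r k x \<le> \<gamma>"
      have t: "\<bar>real (first_increasing_time f x (r k x) \<gamma>) - log L (\<gamma> / r k x)\<bar> \<le> 1 + log L 2"
        using time[of A x "r k x" \<gamma>] x k r0[of k x] \<gamma> \<epsilon> by auto
      have tS: "\<bar>real (first_increasing_time f x (r (Suc k) x) \<gamma>) - log L (\<gamma> / r (Suc k) x)\<bar>
          \<le> 1 + log L 2"
        using time[of A x "r (Suc k) x" \<gamma>] x k r0[of "Suc k" x] rdec[of k x] \<gamma> \<epsilon> by auto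
      have t\<epsilon>: "\<bar>real (first_increasing_time f x (r k x) \<epsilon>) - log L (\<epsilon> / r k x)\<bar> \<le> 1 + log L 2"
        using time[of A x "r k x" \<epsilon>] x k r0[of k x] \<gamma> \<epsilon> by auto
      have "log L (\<gamma> / r (Suc k) x) = log L (\<gamma> / r k x * L)" by (simp add: rS)
      also have "\<dots> = log L (\<gamma> / r k x) + 1"
        using L \<gamma> r0[of k x] by (subst log_mult) auto
      finally have "log L (\<gamma> / r (Suc k) x) = log L (\<gamma> / r k x) + 1" .
      then show "\<bar>real (first_increasing_time f x (r (Suc k) x) \<gamma>)
          - real (first_increasing_time f x (r k x) \<gamma>)\<bar> \<le> m"
        using t tS log2 log\<epsilon> unfolding m_def by linarith
      have "log L (\<epsilon> / r k x) = log L (\<gamma> / r k x * (\<epsilon> / \<gamma>))" using \<gamma> by simp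
      also have "\<dots> = log L (\<gamma> / r k x) + log L (\<epsilon> / \<gamma>)"
        using L \<gamma> r0[of k x] by (subst log_mult) auto
      finally have "log L (\<epsilon> / r k x) = log L (\<gamma> / r k x) + log L (\<epsilon> / \<gamma>)" .
      then show "\<bar>real (first_increasing_time f x (r k x) \<gamma>)
          - real (first_increasing_time f x (r k x) \<epsilon>)\<bar> \<le> m"
        using t t\<epsilon> log2 log\<epsilon> unfolding m_def by linarith
    qed
  qed
  have sens: "sensitivity_constant f \<epsilon>"
    using sensitivity_constant_if_expanding[OF L \<epsilon>] expand by blast
  show ?thesis
    unfolding first_time_sensitive_def
  proof (rule conjI[OF homeo], rule exI[of _ \<epsilon>], rule conjI[OF sens], rule exI[of _ r],
      intro conjI)
    show "\<exists>c. \<forall>x\<in>M. r 1 x = c" by (simp add: r_def)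
  qed (use r0 rdec rlim times in auto)
qed

end

section \<open>The Hilbert cube\<close>

lemma bdd_above_cube_dist:
  assumes "x \<in> unit_cube" "y \<in> unit_cube"
  shows "bdd_above (range (\<lambda>i. \<bar>x i - y i\<bar> / 2 ^ nat \<bar>i\<bar>))"
proof (rule bdd_aboveI2)
  fix i
  have "\<bar>x i - y i\<bar> \<le> 1" using assms by (simp add: unit_cube_def abs_le_iff) (smt (verit))
  also have "1 \<le> (2::real) ^ nat \<bar>i\<bar>" by simp
  finally show "\<bar>x i - y i\<bar> / 2 ^ nat \<bar>i\<bar> \<le> 1" by (simp add: divide_le_eq)
qed

lemma cube_dist_le_iff:
  assumes "x \<in> unit_cube" "y \<in> unit_cube"
  shows "cube_dist x y \<le> c \<longleftrightarrow> (\<forall>i. \<bar>x i - y i\<bar> \<le> c * 2 ^ nat \<bar>i\<bar>)"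
  using assms cSUP_le_iff[OF _ bdd_above_cube_dist[OF assms]]
  by (simp add: cube_dist_def divide_le_eq)

lemma coordinate_le_cube_dist:
  assumes "x \<in> unit_cube" "y \<in> unit_cube"
  shows "\<bar>x i - y i\<bar> \<le> cube_dist x y * 2 ^ nat \<bar>i\<bar>"
  using cube_dist_le_iff[OF assms, of "cube_dist x y"] by simp

lemma cube_dist_nonneg: "0 \<le> cube_dist x y"
proof (cases "x \<in> unit_cube \<and> y \<in> unit_cube")
  case True
  then show ?thesis using coordinate_le_cube_dist[of x y 0] by simp
next
  case False
  then show ?thesis by (auto simp: cube_dist_def)
qed

lemma Metric_space_cube: "Metric_space unit_cube cube_dist"
proof
  show "0 \<le> cube_dist x y" for x y by (rule cube_dist_nonneg)
  show "cube_dist x y = cube_dist y x" for x y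
    by (auto simp: cube_dist_def abs_minus_commute)
  show "cube_dist x y = 0 \<longleftrightarrow> x = y" if "x \<in> unit_cube" "y \<in> unit_cube" for x y
    using cube_dist_le_iff[OF that, of 0] cube_dist_nonneg[of x y] by (auto simp: fun_eq_iff)
  show "cube_dist x z \<le> cube_dist x y + cube_dist y z"
    if "x \<in> unit_cube" "y \<in> unit_cube" "z \<in> unit_cube" for x y z
  proof (subst cube_dist_le_iff[OF that(1,3)], intro allI)
    fix i
    show "\<bar>x i - z i\<bar> \<le> (cube_dist x y + cube_dist y z) * 2 ^ nat \<bar>i\<bar>"
      using coordinate_le_cube_dist[OF that(1,2), of i] coordinate_le_cube_dist[OF that(2,3), of i]
      unfolding distrib_right by linarith
  qed
qed

interpretation cube: Metric_space unit_cube cube_dist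
  by (rule Metric_space_cube)

lemma compact_unit_cube: "compact unit_cube"
proof -
  have "unit_cube = PiE UNIV (\<lambda>_. {0..1})" by (auto simp: unit_cube_def PiE_def)
  moreover have "compactin (product_topology (\<lambda>_. euclidean) UNIV) (PiE (UNIV :: int set) (\<lambda>_. {0..1::real}))"
    by (subst compactin_PiE) auto
  ultimately show ?thesis by (simp add: euclidean_product_topology)
qed

text \<open>
  Coordinates beyond \<open>N\<close> with \<open>2 ^ N > 2 / e\<close> contribute at most \<open>e / 2\<close> to the distance, whatever
  their values in \<open>[0,1]\<close>. Only the finitely many others have to be controlled.
\<close>

lemma cube_ball_is_product_neighbourhood:
  assumes x: "x \<in> unit_cube" and e: "0 < e"
  shows "\<exists>U. open U \<and> x \<in> U \<and> U \<inter> unit_cube \<subseteq> cube.mball x e"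
proof -
  obtain N where N: "2 / e < (2::real) ^ N" using real_arch_pow[of 2 "2 / e"] by auto
  define U where "U = (\<Inter>i\<in>{- int N..int N}. {y :: int \<Rightarrow> real. \<bar>x i - y i\<bar> < e / 2})"
  have "open U" unfolding U_def
    by (intro open_INT ballI open_Collect_less continuous_intros
        continuous_on_product_coordinates) auto
  moreover have "x \<in> U" using e by (simp add: U_def)
  moreover have "y \<in> cube.mball x e" if "y \<in> U" and y: "y \<in> unit_cube" for y
  proof -
    have "\<bar>x i - y i\<bar> \<le> e / 2 * 2 ^ nat \<bar>i\<bar>" for i
    proof (cases "i \<in> {- int N..int N}")
      case True
      then have "\<bar>x i - y i\<bar> \<le> e / 2 * 1" using \<open>y \<in> U\<close> by (force simp: U_def)
      also have "\<dots> \<le> e / 2 * 2 ^ nat \<bar>i\<bar>" using e by (intro mult_left_mono) auto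
      finally show ?thesis .
    next
      case False
      have "\<bar>x i - y i\<bar> \<le> 1" using x y by (simp add: unit_cube_def abs_le_iff) (smt (verit))
      also have "1 \<le> e / 2 * 2 ^ N" using N e by (simp add: field_simps)
      also have "\<dots> \<le> e / 2 * 2 ^ nat \<bar>i\<bar>"
        using False e by (intro mult_left_mono power_increasing) auto
      finally show ?thesis .
    qed
    then have "cube_dist x y \<le> e / 2" by (subst cube_dist_le_iff[OF x y]) blast
    then show ?thesis using e x y by simp
  qed
  ultimately show ?thesis by blast
qed

lemma compact_space_cube: "compact_space cube.mtopology"
proof -
  have "continuous_map (top_of_set unit_cube) cube.mtopology (\<lambda>x. x)"
    unfolding cube.continuous_map_to_metric
  proof (intro ballI allI impI)
    fix x and e :: real assume "x \<in> topspace (top_of_set unit_cube)" "0 < e"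
    then obtain U where "open U" "x \<in> U" "U \<inter> unit_cube \<subseteq> cube.mball x e" "x \<in> unit_cube"
      using cube_ball_is_product_neighbourhood[of x e] by auto
    then show "\<exists>U. openin (top_of_set unit_cube) U \<and> x \<in> U \<and> (\<forall>y\<in>U. y \<in> cube.mball x e)"
      by (intro exI[of _ "unit_cube \<inter> U"]) auto
  qed
  moreover have "compactin (top_of_set unit_cube) unit_cube"
    using compact_unit_cube by (simp add: compactin_subtopology)
  ultimately show ?thesis
    using image_compactin[of "top_of_set unit_cube" unit_cube cube.mtopology "\<lambda>x. x"]
    by (simp add: compact_space_def)
qed

section \<open>The shift\<close>

lemma funpow_shift: "(shift ^^ n) x = (\<lambda>i. x (i + int n))"
  by (induction n arbitrary: x) (auto simp: shift_def fun_eq_iff add_ac)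

text \<open>Taking \<open>c\<close> to be \<open>1\<close> or \<open>-1\<close> treats the shift and its inverse at once.\<close>

lemma cube_dist_translate_le:
  assumes x: "x \<in> unit_cube" and y: "y \<in> unit_cube"
    and c: "\<bar>c\<bar> \<le> 1"
  shows "cube_dist (\<lambda>i. x (i + c)) (\<lambda>i. y (i + c)) \<le> 2 * cube_dist x y"
proof -
  have "\<bar>x (i + c) - y (i + c)\<bar> \<le> 2 * cube_dist x y * 2 ^ nat \<bar>i\<bar>" for i
  proof -
    have "\<bar>x (i + c) - y (i + c)\<bar> \<le> cube_dist x y * 2 ^ nat \<bar>i + c\<bar>"
      by (rule coordinate_le_cube_dist[OF x y])
    also have "\<dots> \<le> cube_dist x y * 2 ^ Suc (nat \<bar>i\<bar>)"
      using c cube_dist_nonneg by (intro mult_left_mono power_increasing) auto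
    finally show ?thesis by simp
  qed
  moreover have "(\<lambda>i. x (i + c)) \<in> unit_cube" "(\<lambda>i. y (i + c)) \<in> unit_cube"
    using x y by (auto simp: unit_cube_def)
  ultimately show ?thesis by (simp add: cube_dist_le_iff)
qed

lemma continuous_map_translate:
  assumes c: "\<bar>c\<bar> \<le> (1::int)"
  shows "continuous_map cube.mtopology cube.mtopology (\<lambda>x i. x (i + c))"
  unfolding cube.metric_continuous_map[OF Metric_space_cube]
proof (intro conjI ballI allI impI)
  show "(\<lambda>x i. x (i + c)) ` unit_cube \<subseteq> unit_cube" by (auto simp: unit_cube_def)
next
  fix x and e :: real assume "x \<in> unit_cube" "0 < e"
  then show "\<exists>\<delta>>0. \<forall>y. y \<in> unit_cube \<and> cube_dist x y < \<delta> \<longrightarrow>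
      cube_dist (\<lambda>i. x (i + c)) (\<lambda>i. y (i + c)) < e"
    using cube_dist_translate_le[OF _ _ c, of x] by (intro exI[of _ "e / 2"]) force
qed

lemma homeomorphic_map_shift: "homeomorphic_map cube.mtopology cube.mtopology shift"
proof -
  have "homeomorphic_maps cube.mtopology cube.mtopology shift (\<lambda>x i. x (i + (-1)))"
    using continuous_map_translate[of 1] continuous_map_translate[of "-1"]
    by (auto simp: homeomorphic_maps_def shift_def[abs_def])
  then show ?thesis using homeomorphic_map_maps by blast
qed

text \<open>
  The witness \<open>y\<close> moves coordinate \<open>n\<close> of \<open>x\<close> towards the farther end of \<open>[0,1]\<close>, where there is
  room for \<open>a \<le> 1/2\<close>. Its weight is \<open>2 ^ -n\<close> now and \<open>1\<close> after \<open>n\<close> shifts.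
\<close>

lemma shift_expands:
  assumes x: "x \<in> unit_cube" and a: "0 < a" "a \<le> 1/2"
  shows "\<exists>y\<in>unit_cube. cube_dist x y \<le> a / 2 ^ n \<and>
           a \<le> cube_dist ((shift ^^ n) x) ((shift ^^ n) y)"
proof -
  define b where "b = (if x (int n) \<le> 1/2 then x (int n) + a else x (int n) - a)"
  define y where "y = x(int n := b)"
  have xn: "0 \<le> x i \<and> x i \<le> 1" for i using x by (simp add: unit_cube_def)
  have "0 \<le> b \<and> b \<le> 1" using xn[of "int n"] a by (auto simp: b_def)
  then have y: "y \<in> unit_cube" using x by (auto simp: y_def unit_cube_def)
  have diff: "\<bar>x (int n) - y (int n)\<bar> = a" using a by (simp add: y_def b_def)
  have "\<bar>x i - y i\<bar> \<le> a / 2 ^ n * 2 ^ nat \<bar>i\<bar>" for i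
    using diff a by (cases "i = int n") (auto simp: y_def)
  then have "cube_dist x y \<le> a / 2 ^ n" by (simp add: cube_dist_le_iff x y)
  moreover have "(shift ^^ n) x \<in> unit_cube" "(shift ^^ n) y \<in> unit_cube"
    using x y by (auto simp: funpow_shift unit_cube_def)
  then have "a \<le> cube_dist ((shift ^^ n) x) ((shift ^^ n) y)"
    using coordinate_le_cube_dist[of "(shift ^^ n) x" "(shift ^^ n) y" 0] diff
    by (simp add: funpow_shift)
  ultimately show ?thesis using y by blast
qed

theorem theorem3p7:
  shows "Metric_space unit_cube cube_dist \<and>
    compact_space (Metric_space.mtopology unit_cube cube_dist) \<and>
    Metric_space.first_time_sensitive unit_cube cube_dist shift"
proof (intro conjI)
  show "cube.first_time_sensitive shift"
  proof (rule cube.first_time_sensitive_if_exact_expansion_rate[where L = 2 and A = "1/2"])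
    show "cube_dist (shift u) (shift v) \<le> 2 * cube_dist u v"
      if "u \<in> unit_cube" "v \<in> unit_cube" for u v
      using cube_dist_translate_le[OF that, of 1] by (simp add: shift_def)
  qed (use homeomorphic_map_shift shift_expands in auto)
qed (use Metric_space_cube compact_space_cube in auto)

end
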